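(* The function $Q_E:[0,1]\to[0,1]$ is singular; that is, for Lebesgue-almost every $x\in[0,1]$ the derivative $Q_E'(x)$ exists and equals $0$.
   Context: Even continued fractions (ECF). Write $$[(e_1,a_1),(e_2,a_2),\ldots,(e_n,a_n)]=\cfrac{e_1}{a_1+\cfrac{e_2}{a_2+\cdots+\cfrac{e_n}{a_n}}}.$$ A finite ECF expansion has $e_i\in\{\pm1\}$ and every $a_i$ a positive even integer, except that the last partial quotient $a_n$ is also allowed to equal $1$ provided $e_n=1$. For numbers in $(0,1]$ one has $e_1=1$. With this convention every rational in $(0,1]$ has a unique finite ECF expansion; $0$ has the empty expansion. For $k\ge 0$ let $\mathcal{Y}_k$ be the set of rationals in $[0,1]$ whose finite ECF expansion satisfies $a_1+\cdots+a_n\le 2k+1$ (in particular $0,1\in\mathcal{Y}_k$); it has $3^k+1$ elements. For $x\in\mathcal{Y}_k$ define $Q_E(x)=3^{-k}|\{y\in\mathcal{Y}_k: y<x\}|$, which does not depend on the choice of $k$ with $x\in\mathcal{Y}_k$. For arbitrary $x\in[0,1]$, $Q_E(x)=\lim_{n\to\infty}3^{-n}|\{y\in\mathcal{Y}_n:y<x\}|$, which agrees with the previous definition for rational $x$ and is the extension of $Q_E$ from $\mathbb{Q}\cap[0,1]$ to $[0,1]$ by continuity. *)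

theory Defs
  imports "HOL-Analysis.Analysis"
begin

fun ecf_value :: "(int \<times> nat) list \<Rightarrow> real" where
  "ecf_value [] = 0"
| "ecf_value ((e, a) # xs) = of_int e / (of_nat a + ecf_value xs)"

text \<open>Finite even continued fraction expansions of numbers in \<open>[0,1]\<close>, so the leading
  sign is \<open>1\<close>. The empty list is the expansion of \<open>0\<close>.\<close>

definition ecf_expansion :: "(int \<times> nat) list \<Rightarrow> bool" where
  "ecf_expansion xs \<longleftrightarrow>
     (xs \<noteq> [] \<longrightarrow> fst (hd xs) = 1) \<and>
     (\<forall>i<length xs. fst (xs ! i) \<in> {1, -1} \<and>
        (even (snd (xs ! i)) \<and> snd (xs ! i) > 0 \<or>
         i = length xs - 1 \<and> snd (xs ! i) = 1 \<and> fst (xs ! i) = 1))"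

text \<open>Expansions being unique, ``the expansion of \<open>x\<close> has digit sum at most \<open>2k+1\<close>'' is
  expressed by an existential quantifier.\<close>

definition Y :: "nat \<Rightarrow> real set" where
  "Y k = {x \<in> \<rat> \<inter> {0..1}. \<exists>xs. ecf_expansion xs \<and> ecf_value xs = x \<and>
            sum_list (map snd xs) \<le> 2 * k + 1}"

text \<open>The formula makes sense on all of \<open>\<real>\<close>, but only its values on \<open>[0,1]\<close> are meant.\<close>

definition Q_E :: "real \<Rightarrow> real" where
  "Q_E x = lim (\<lambda>n. real (card {y \<in> Y n. y < x}) / 3 ^ n)"

end

theory Submission
  imports Defs
begin

text \<open>
  Splitting an expansion at its first digit shows that the grids \<open>Y n\<close> are generated by three
  Moebius branches, \<open>y / (1 + 2 y)\<close>, \<open>1 / (2 + y)\<close> and \<open>1 / (2 - y)\<close>, which map \<open>[0,1]\<close> onto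
  \<open>[0,1/3]\<close>, \<open>[1/3,1/2]\<close> and \<open>[1/2,1]\<close>. Hence \<open>Y n\<close> cuts \<open>[0,1]\<close> into \<open>3 ^ n\<close> intervals on each of
  which \<open>Q_E\<close> varies by at most \<open>3 ^ (-n)\<close>, while their lengths are very uneven. This unevenness
  makes \<open>Q_E\<close> singular.

  It is quantified by square roots of lengths. An interval between fractions with denominators
  \<open>a\<close> and \<open>b\<close> is cut in the proportions \<open>b / (2 a + b)\<close>, \<open>a b / ((a + b) (2 a + b))\<close>,
  \<open>a / (a + b)\<close>. For equal thirds, the sum of the square roots of the proportions would be
  \<open>sqrt 3 = 1.732...\<close>; but the middle proportion never exceeds \<open>3 - 2 sqrt 2 < 9/50\<close>, and this
  keeps the sum below \<open>\<kappa> = 171/100\<close>, whatever \<open>a\<close> and \<open>b\<close> are (\<open>sqrt_ratios_sum_le\<close>).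

  Consider the points within distance \<open>d\<close> of \<open>Y n\<close>. In one of the \<open>3 ^ n\<close> intervals, of length
  \<open>l\<close>, they have measure at most \<open>min l (2 d) \<le> sqrt (2 d l)\<close>, so in total at most \<open>\<kappa> ^ n * sqrt (2 d)\<close>
  (\<open>measure_near_le\<close>). With \<open>d = \<lambda> ^ n\<close> and \<open>\<lambda> = 17/50\<close> this is summable, because \<open>\<kappa>\<^sup>2 * \<lambda> < 1\<close>;
  such a \<open>\<lambda> > 1/3\<close> exists precisely because \<open>\<kappa> < sqrt 3\<close>. By Borel--Cantelli almost every \<open>x\<close> has
  distance at least \<open>\<lambda> ^ n\<close> from \<open>Y n\<close> for all large \<open>n\<close>.

  For such an \<open>x\<close> and \<open>y\<close> close to it, take the first level \<open>n\<close> with a grid point between them. That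
  point is at distance at least \<open>\<lambda> ^ n\<close> from \<open>x\<close>, so \<open>\<lambda> ^ n \<le> \<bar>y - x\<bar>\<close>; nothing separates them at
  level \<open>n - 1\<close>, so \<open>\<bar>Q_E y - Q_E x\<bar> \<le> 3 ^ (1 - n)\<close> (\<open>Q_E_gap\<close>). The difference quotient is at most
  \<open>3 / (3 \<lambda>) ^ n\<close>, and \<open>n\<close> tends to infinity as \<open>y\<close> tends to \<open>x\<close>.
\<close>

section \<open>The ternary structure of the expansions\<close>

text \<open>Admissibility of a digit list without the condition on its first sign; unlike
  \<^const>\<open>ecf_expansion\<close>, this is inherited by tails.\<close>

fun ecf_tail :: "(int \<times> nat) list \<Rightarrow> bool" where
  "ecf_tail [] \<longleftrightarrow> True"
| "ecf_tail ((e, a) # xs) \<longleftrightarrow> e \<in> {1, -1} \<and>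
     (even a \<and> 0 < a \<and> ecf_tail xs \<or> a = 1 \<and> e = 1 \<and> xs = [])"

lemma all_less_Suc_shift: "(\<forall>i<Suc n. P i) \<longleftrightarrow> P 0 \<and> (\<forall>i<n. P (Suc i))"
  using less_Suc_eq_0_disj by auto

lemma ecf_tail_iff:
  "ecf_tail xs \<longleftrightarrow> (\<forall>i<length xs. fst (xs ! i) \<in> {1, -1} \<and>
        (even (snd (xs ! i)) \<and> snd (xs ! i) > 0 \<or>
         i = length xs - 1 \<and> snd (xs ! i) = 1 \<and> fst (xs ! i) = 1))"
proof (induction xs rule: ecf_tail.induct)
  case (2 e a xs)
  show ?case
  proof (cases xs)
    case Nil
    then show ?thesis by auto
  next
    case (Cons x ys)
    then have "Suc i = length ((e, a) # xs) - 1 \<longleftrightarrow> i = length xs - 1" for i by auto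
    then show ?thesis using 2 Cons by (auto simp: all_less_Suc_shift)
  qed
qed simp

lemma ecf_expansion_iff:
  "ecf_expansion xs \<longleftrightarrow> (xs \<noteq> [] \<longrightarrow> fst (hd xs) = 1) \<and> ecf_tail xs"
  unfolding ecf_expansion_def ecf_tail_iff ..

lemma ecf_expansion_Cons:
  "ecf_expansion ((e, a) # xs) \<longleftrightarrow>
     e = 1 \<and> (even a \<and> 0 < a \<and> ecf_tail xs \<or> a = 1 \<and> xs = [])"
  by (auto simp: ecf_expansion_iff)

text \<open>A digit other than a final \<open>1\<close> is at least \<open>2\<close>, so if the tail has absolute value at most \<open>1\<close>,
  the denominator is at least \<open>1\<close>.\<close>

lemma ecf_tail_value: "ecf_tail xs \<Longrightarrow> \<bar>ecf_value xs\<bar> \<le> 1 \<and> ecf_value xs \<in> \<rat>"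
proof (induction xs rule: ecf_tail.induct)
  case (2 e a xs)
  show ?case
  proof (cases "a = 1 \<and> e = 1 \<and> xs = []")
    case False
    with 2 have a: "even a" "0 < a" "ecf_tail xs" by auto
    then have "2 \<le> a" by auto
    then have "2 \<le> real a" by linarith
    with 2 a have "1 \<le> real a + ecf_value xs" by (smt (verit))
    then show ?thesis using 2 a by (auto simp: field_simps)
  qed auto
qed simp

lemma ecf_expansion_value:
  assumes "ecf_expansion xs"
  shows "ecf_value xs \<in> \<rat> \<inter> {0..1}"
proof (cases xs)
  case (Cons x ys)
  obtain e a where x: "x = (e, a)" by (cases x)
  from assms Cons x have t: "ecf_tail xs" "e = 1" "even a \<and> 0 < a \<and> ecf_tail ys \<or> a = 1 \<and> ys = []"
    by (auto simp: ecf_expansion_iff)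
  then have "0 \<le> real a + ecf_value ys" using ecf_tail_value[of ys] by (cases a) auto
  then show ?thesis using ecf_tail_value[OF t(1)] t Cons x by auto
qed simp

lemma Y_altdef:
  "Y k = {ecf_value xs | xs. ecf_expansion xs \<and> sum_list (map snd xs) \<le> 2 * k + 1}"
  using ecf_expansion_value unfolding Y_def by blast

lemma Y_0: "Y 0 = {0, 1}"
proof -
  have "ecf_expansion xs \<and> sum_list (map snd xs) \<le> 1 \<longleftrightarrow> xs = [] \<or> xs = [(1, 1)]" for xs
  proof (cases xs)
    case (Cons x ys)
    obtain e a where x: "x = (e, a)" by (cases x)
    show ?thesis using Cons x by (cases "a = 0"; cases "a = 1") (auto simp: ecf_expansion_Cons)
  qed (simp add: ecf_expansion_iff)
  then have "Y 0 = {ecf_value xs | xs. xs = [] \<or> xs = [(1, 1)]}"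
    unfolding Y_altdef by (simp only: mult_0_right add_0)
  also have "\<dots> = {ecf_value [], ecf_value [(1, 1)]}" by blast
  also have "\<dots> = {0, 1}" by simp
  finally show ?thesis .
qed

text \<open>On expansions, \<open>branch0\<close> adds \<open>2\<close> to the first digit, and \<open>branch1\<close>, \<open>branch2\<close> prepend the digit
  \<open>2\<close> and make the sign after it \<open>1\<close> or \<open>-1\<close>. Each raises the digit sum by at most \<open>2\<close>.
  Exceptional are the point \<open>0\<close>, fixed by \<open>branch0\<close>, and the point \<open>1\<close>, which is fixed by \<open>branch2\<close>
  and sent by \<open>branch0\<close> to \<open>1/3\<close>, with digits \<open>2, 1\<close>.\<close>

definition branch0 :: "real \<Rightarrow> real" where "branch0 y = y / (1 + 2 * y)"
definition branch1 :: "real \<Rightarrow> real" where "branch1 y = 1 / (2 + y)"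
definition branch2 :: "real \<Rightarrow> real" where "branch2 y = 1 / (2 - y)"

lemma Y_Suc_subset:
  assumes "x \<in> Y (Suc k)"
  shows "x \<in> branch0 ` Y k \<union> branch1 ` Y k \<union> branch2 ` Y k"
proof -
  from assms obtain xs where xs: "ecf_expansion xs" "sum_list (map snd xs) \<le> 2 * k + 3"
    and x: "x = ecf_value xs" by (auto simp: Y_altdef)
  have Y0: "0 \<in> Y k" unfolding Y_altdef by (rule CollectI, rule exI[of _ "[]"]) (simp add: ecf_expansion_iff)
  have Y1: "1 \<in> Y k" unfolding Y_altdef
    by (rule CollectI, rule exI[of _ "[(1,1)]"]) (simp add: ecf_expansion_iff)
  show ?thesis
  proof (cases xs)
    case Nil
    then have "x = branch0 0" using x by (simp add: branch0_def)
    then show ?thesis using Y0 by blast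
  next
    case (Cons d ys)
    obtain a where d: "d = (1, a)" using Cons xs by (cases d) (auto simp: ecf_expansion_Cons)
    with Cons xs consider "a = 1" "ys = []" | "even a" "4 \<le> a" "ecf_tail ys" | "a = 2" "ecf_tail ys"
      by (force simp: ecf_expansion_Cons elim!: evenE)
    then show ?thesis
    proof cases
      case 1
      then have "x = branch2 1" using x Cons d by (simp add: branch2_def)
      then show ?thesis using Y1 by blast
    next
      case 2
      define y where "y = ecf_value ((1, a - 2) # ys)"
      have "y \<in> Y k" unfolding Y_altdef y_def
        by (rule CollectI, rule exI[of _ "(1, a - 2) # ys"])
          (use 2 xs Cons d in \<open>auto simp: ecf_expansion_Cons\<close>)
      moreover have "x = branch0 y"
      proof -
        define t where "t = real a - 2 + ecf_value ys"
        have "t > 0" using ecf_tail_value[OF 2(3)] 2(2) unfolding t_def by linarith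
        moreover have "x = 1 / (t + 2)" using x Cons d 2 by (simp add: t_def algebra_simps)
        moreover have y: "y = 1 / t" using 2 by (simp add: t_def y_def)
        ultimately show ?thesis unfolding y branch0_def by (simp add: field_simps)
      qed
      ultimately show ?thesis by blast
    next
      case 3
      show ?thesis
      proof (cases ys)
        case Nil
        then have "x = branch1 0" using x Cons d 3 by (simp add: branch1_def)
        then show ?thesis using Y0 by blast
      next
        case ys: (Cons c zs)
        obtain e b where c: "c = (e, b)" by (cases c)
        have "ecf_value ((1, b) # zs) \<in> Y k" unfolding Y_altdef
          by (rule CollectI, rule exI[of _ "(1, b) # zs"])
            (use 3 xs Cons d ys c in \<open>auto simp: ecf_expansion_Cons\<close>)
        moreover have "x = (if e = 1 then branch1 else branch2) (ecf_value ((1, b) # zs))"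
          using x Cons d 3 ys c by (auto simp: branch1_def branch2_def)
        ultimately show ?thesis by (metis UnCI imageI)
      qed
    qed
  qed
qed

lemma Y_Suc_supset:
  assumes "y \<in> Y k"
  shows "branch0 y \<in> Y (Suc k)" "branch1 y \<in> Y (Suc k)" "branch2 y \<in> Y (Suc k)"
proof -
  from assms obtain xs where xs: "ecf_expansion xs" "sum_list (map snd xs) \<le> 2 * k + 1"
    and y: "y = ecf_value xs" by (auto simp: Y_altdef)
  have *: "z \<in> Y (Suc k)"
    if "ecf_expansion zs" "sum_list (map snd zs) \<le> 2 * k + 3" "z = ecf_value zs" for z zs
    unfolding Y_altdef using that by (intro CollectI exI[of _ zs]) simp
  show "branch1 y \<in> Y (Suc k)"
    by (rule *[of "(1, 2) # xs"])
      (use xs y in \<open>auto simp: ecf_expansion_Cons branch1_def ecf_expansion_iff\<close>)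
  have "branch0 y \<in> Y (Suc k) \<and> branch2 y \<in> Y (Suc k)"
  proof (cases xs)
    case Nil
    have "branch0 y \<in> Y (Suc k)"
      by (rule *[of "[]"]) (use Nil xs y in \<open>auto simp: branch0_def\<close>)
    moreover have "branch2 y \<in> Y (Suc k)"
      by (rule *[of "[(1, 2)]"]) (use Nil xs y in \<open>auto simp: branch2_def ecf_expansion_Cons\<close>)
    ultimately show ?thesis ..
  next
    case (Cons d ys)
    obtain a where d: "d = (1, a)" using Cons xs by (cases d) (auto simp: ecf_expansion_Cons)
    with Cons xs consider "a = 1" "ys = []" | "even a" "2 \<le> a" "ecf_tail ys"
      by (force simp: ecf_expansion_Cons elim!: evenE)
    then show ?thesis
    proof cases
      case 1
      have "branch0 y \<in> Y (Suc k)"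
        by (rule *[of "[(1, 2), (1, 1)]"])
          (use 1 Cons d y in \<open>auto simp: branch0_def ecf_expansion_Cons\<close>)
      moreover have "branch2 y \<in> Y (Suc k)"
        by (rule *[of "[(1, 1)]"]) (use 1 Cons d y in \<open>auto simp: branch2_def ecf_expansion_Cons\<close>)
      ultimately show ?thesis ..
    next
      case 2
      define t where "t = real a + ecf_value ys"
      have t: "t > 0" using ecf_tail_value[OF 2(3)] 2(2) unfolding t_def by linarith
      have y': "y = 1 / t" using y Cons d by (simp add: t_def)
      have "branch0 y = 1 / (t + 2)" using t by (simp add: y' branch0_def field_simps)
      then have "branch0 y \<in> Y (Suc k)"
        by (intro *[of "(1, a + 2) # ys"])
          (use 2 xs Cons d in \<open>auto simp: ecf_expansion_Cons t_def algebra_simps\<close>)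
      moreover have "branch2 y \<in> Y (Suc k)"
        by (rule *[of "(1, 2) # (-1, a) # ys"])
          (use 2 xs Cons d y' in \<open>auto simp: ecf_expansion_Cons branch2_def t_def\<close>)
      ultimately show ?thesis ..
    qed
  qed
  then show "branch0 y \<in> Y (Suc k)" "branch2 y \<in> Y (Suc k)" by auto
qed

lemma Y_Suc: "Y (Suc k) = branch0 ` Y k \<union> branch1 ` Y k \<union> branch2 ` Y k"
  using Y_Suc_subset Y_Suc_supset by blast

section \<open>Subdivision by mediants\<close>

text \<open>A fraction \<open>p / q\<close> is represented by the vector \<open>(p, q)\<close>, so that mediants become sums and Moebius
  maps become linear maps.\<close>

definition val :: "real \<times> real \<Rightarrow> real" where "val u = fst u / snd u"

type_synonym pair = "(real \<times> real) \<times> (real \<times> real)"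

text \<open>The interval between \<open>u\<close> and \<open>v\<close> is cut at \<open>2 u + v\<close> and \<open>u + v\<close>, as \<open>[0,1]\<close> is at \<open>1/3\<close> and \<open>1/2\<close>
  when \<open>u = (0, 1)\<close> and \<open>v = (1, 1)\<close>. The cut is not symmetric in \<open>u\<close> and \<open>v\<close>. Starting
  from that pair, first components are the images of \<open>0\<close> under compositions of the branches; they
  need not be left endpoints, since \<open>1 / (2 + y)\<close> is decreasing.\<close>

fun grid :: "nat \<Rightarrow> pair \<Rightarrow> (real \<times> real) set" where
  "grid 0 (u, v) = {u, v}"
| "grid (Suc n) (u, v) = grid n (u, u + u + v) \<union> grid n (u + v, u + u + v) \<union> grid n (u + v, v)"

definition pts :: "nat \<Rightarrow> pair \<Rightarrow> real set" where "pts n P = val ` grid n P"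

definition lo :: "pair \<Rightarrow> real" where "lo P = min (val (fst P)) (val (snd P))"
definition hi :: "pair \<Rightarrow> real" where "hi P = max (val (fst P)) (val (snd P))"

definition proper :: "pair \<Rightarrow> bool" where
  "proper P \<longleftrightarrow> 0 < snd (fst P) \<and> 0 < snd (snd P) \<and> val (fst P) \<noteq> val (snd P)"

lemma grid_linear_image:
  assumes "\<And>u v. F (u + v) = F u + F v"
  shows "grid n (F u, F v) = F ` grid n (u, v)"
proof (induction n arbitrary: u v)
  case (Suc n)
  show ?case
    using Suc[of u "u + u + v"] Suc[of "u + v" "u + u + v"] Suc[of "u + v" v]
    by (simp add: assms image_Un)
qed simp

lemma grid_snd_pos:
  assumes "0 < snd u" "0 < snd v" "w \<in> grid n (u, v)"
  shows "0 < snd w"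
  using assms
proof (induction n arbitrary: u v)
  case (Suc n)
  from Suc.prems consider "w \<in> grid n (u, u + u + v)" | "w \<in> grid n (u + v, u + u + v)"
    | "w \<in> grid n (u + v, v)" by auto
  then show ?case
    by cases (erule Suc.IH[rotated 2]; use Suc.prems in \<open>simp add: add_pos_pos\<close>)+
qed auto

lemma finite_grid: "finite (grid n P)"
  by (induction n P rule: grid.induct) auto

abbreviation unit_pair :: pair where "unit_pair \<equiv> ((0, 1), (1, 1))"

text \<open>\<open>Y_Suc\<close> applies a new branch outermost, whereas \<open>grid\<close> subdivides the finest intervals. The two
  recursions agree because the branches are linear on vectors and so commute with subdivision.\<close>

lemma Y_eq_pts: "Y n = pts n unit_pair"
proof (induction n)
  case 0
  then show ?case by (simp add: Y_0 pts_def val_def)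
next
  case (Suc n)
  define F0 F1 F2 :: "real \<times> real \<Rightarrow> real \<times> real" where
    "F0 = (\<lambda>(p, q). (p, q + 2 * p))" and "F1 = (\<lambda>(p, q). (q, 2 * q + p))"
    and "F2 = (\<lambda>(p, q). (q, 2 * q - p))"
  have pos: "snd w > 0" if "w \<in> grid n unit_pair" for w
    using grid_snd_pos[OF _ _ that] by simp
  have v0: "val ` F0 ` grid n unit_pair = branch0 ` val ` grid n unit_pair"
    unfolding image_image using pos
    by (intro image_cong) (force simp: F0_def val_def branch0_def field_simps split: prod.splits)+
  have v1: "val ` F1 ` grid n unit_pair = branch1 ` val ` grid n unit_pair"
    unfolding image_image using pos
    by (intro image_cong) (force simp: F1_def val_def branch1_def field_simps split: prod.splits)+
  have v2: "val ` F2 ` grid n unit_pair = branch2 ` val ` grid n unit_pair"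
    unfolding image_image using pos
    by (intro image_cong) (force simp: F2_def val_def branch2_def field_simps split: prod.splits)+
  have "grid n (F0 (0,1), F0 (1,1)) = F0 ` grid n unit_pair"
    "grid n (F1 (0,1), F1 (1,1)) = F1 ` grid n unit_pair"
    "grid n (F2 (0,1), F2 (1,1)) = F2 ` grid n unit_pair"
    by (rule grid_linear_image; force simp: F0_def F1_def F2_def)+
  then have "grid (Suc n) unit_pair
      = F0 ` grid n unit_pair \<union> F1 ` grid n unit_pair \<union> F2 ` grid n unit_pair"
    by (simp add: F0_def F1_def F2_def)
  then show ?case
    unfolding Y_Suc Suc pts_def by (simp only: image_Un v0 v1 v2)
qed

text \<open>Bounding each root by the tangent of \<open>sqrt\<close> at \<open>t\<^sup>2\<close>, with \<open>t = 2/3\<close> for the outer proportions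
  and \<open>t = 2/5\<close> for the middle one, gives an affine expression in the proportions, which add up to
  \<open>1\<close>. These \<open>t\<close> are close to the roots at the extremal position, where the middle proportion is
  about \<open>0.17\<close>. The result must stay below \<open>sqrt 3\<close>.\<close>

lemma sqrt_ratios_sum_le:
  fixes a b :: real
  assumes "0 < a" "0 < b"
  shows "sqrt (b / (2 * a + b)) + sqrt (a * b / ((a + b) * (2 * a + b))) + sqrt (a / (a + b))
           \<le> 171 / 100"
proof -
  have amgm: "sqrt r \<le> (r / t + t) / 2" if "0 \<le> r" "0 < t" for r t :: real
    using arith_geo_mean_sqrt[of "r / t" t] that by simp
  define r1 r2 r3 where "r1 = b / (2 * a + b)" and "r2 = a * b / ((a + b) * (2 * a + b))"
    and "r3 = a / (a + b)"
  have nonneg: "0 \<le> r1" "0 \<le> r2" "0 \<le> r3" using assms by (auto simp: r1_def r2_def r3_def)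
  have sum1: "r1 + r2 + r3 = 1"
    using assms unfolding r1_def r2_def r3_def
    by (simp add: divide_simps add_pos_pos less_imp_neq[THEN not_sym]) (simp add: algebra_simps)
  \<comment> \<open>Completing the square in \<open>9/50 * (a + b) * (2 a + b) - a b = 9/25 a\<^sup>2 - 23/50 a b + 9/50 b\<^sup>2\<close>.\<close>
  have "0 \<le> (3 / 5 * a - 23 / 60 * b)\<^sup>2 + (18 / 100 - (23 / 60)\<^sup>2) * b\<^sup>2"
    by (intro add_nonneg_nonneg mult_nonneg_nonneg) (auto simp: power2_eq_square)
  then have "a * b \<le> 9 / 50 * ((a + b) * (2 * a + b))"
    by (simp add: power2_eq_square algebra_simps)
  then have r2: "r2 \<le> 9 / 50"
    using assms unfolding r2_def by (subst pos_divide_le_eq) auto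
  have "sqrt r1 + sqrt r2 + sqrt r3
      \<le> (r1 / (2/3) + 2/3) / 2 + (r2 / (2/5) + 2/5) / 2 + (r3 / (2/3) + 2/3) / 2"
    using nonneg by (intro add_mono amgm) auto
  also have "\<dots> = 3 / 4 * (r1 + r2 + r3) + r2 / 2 + 13 / 15" by (simp add: field_simps)
  also have "\<dots> \<le> 171 / 100" using r2 unfolding sum1 by simp
  finally show ?thesis by (simp only: r1_def r2_def r3_def)
qed

text \<open>The three parts are listed from left to right, which hides the orientation of the pair from
  everything that follows.\<close>

lemma proper_split:
  assumes "proper P"
  obtains P1 P2 P3 where "proper P1" "proper P2" "proper P3"
    "lo P1 = lo P" "lo P2 = hi P1" "lo P3 = hi P2" "hi P3 = hi P"
    "\<And>n. pts (Suc n) P = pts n P1 \<union> pts n P2 \<union> pts n P3"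
    "sqrt (hi P1 - lo P1) + sqrt (hi P2 - lo P2) + sqrt (hi P3 - lo P3)
       \<le> 171 / 100 * sqrt (hi P - lo P)"
proof -
  obtain p a q b where P: "P = ((p, a), (q, b))" by (metis surj_pair)
  define x y where "x = p / a" and "y = q / b"
  have ab: "0 < a" "0 < b" and xy: "x \<noteq> y"
    using assms by (auto simp: P proper_def val_def x_def y_def)
  define A B C where "A = ((p, a), (p + p + q, a + a + b))"
    and "B = ((p + q, a + b), (p + p + q, a + a + b))" and "C = ((p + q, a + b), (q, b))"
  define r1 r2 r3 where "r1 = b / (2 * a + b)" and "r2 = a * b / ((a + b) * (2 * a + b))"
    and "r3 = a / (a + b)"
  have rpos: "0 < r1" "0 < r2" "0 < r3" using ab by (auto simp: r1_def r2_def r3_def)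
  have sum1: "r1 + r2 + r3 = 1"
    using ab unfolding r1_def r2_def r3_def
    by (simp add: divide_simps add_pos_pos less_imp_neq[THEN not_sym]) (simp add: algebra_simps)
  have v: "p / a = x" "q / b = y" by (auto simp: x_def y_def)
  have pq: "p = x * a" "q = y * b" using ab by (auto simp: x_def y_def)
  have v1: "(p + p + q) / (a + a + b) = x + r1 * (y - x)"
    using ab unfolding r1_def pq
    by (simp add: divide_simps add_pos_pos less_imp_neq[THEN not_sym]) (simp add: algebra_simps)
  have v2: "(p + q) / (a + b) = y - r3 * (y - x)"
    using ab unfolding r3_def pq
    by (simp add: divide_simps add_pos_pos less_imp_neq[THEN not_sym]) (simp add: algebra_simps)
  have v12: "y - r3 * (y - x) = (x + r1 * (y - x)) + r2 * (y - x)"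
  proof -
    have r3: "r3 = 1 - r1 - r2" using sum1 by simp
    show ?thesis unfolding r3 by (simp add: algebra_simps)
  qed
  have vals: "val (fst P) = x" "val (snd P) = y"
    "val (fst A) = x" "val (snd A) = x + r1 * (y - x)"
    "val (fst B) = (x + r1 * (y - x)) + r2 * (y - x)" "val (snd B) = x + r1 * (y - x)"
    "val (fst C) = y - r3 * (y - x)" "val (snd C) = y"
    unfolding A_def B_def C_def P val_def fst_conv snd_conv v v1 v2 v12 by (rule refl)+
  have pts: "pts (Suc n) P = pts n A \<union> pts n B \<union> pts n C" for n
    by (auto simp: pts_def P A_def B_def C_def)
  have len: "\<bar>r1 * (y - x)\<bar> = r1 * \<bar>y - x\<bar>" "\<bar>r2 * (y - x)\<bar> = r2 * \<bar>y - x\<bar>"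
    "\<bar>r3 * (y - x)\<bar> = r3 * \<bar>y - x\<bar>" using rpos by (auto simp: abs_mult)
  have hilo: "hi X - lo X = \<bar>val (snd X) - val (fst X)\<bar>" for X
    by (auto simp: hi_def lo_def)
  have lenA: "hi A - lo A = r1 * \<bar>y - x\<bar>" and lenC: "hi C - lo C = r3 * \<bar>y - x\<bar>"
    and lenP: "hi P - lo P = \<bar>y - x\<bar>"
    using len unfolding hilo vals by simp_all
  have lenB: "hi B - lo B = r2 * \<bar>y - x\<bar>"
    using len(2) unfolding hilo vals by simp
  have "sqrt (hi A - lo A) + sqrt (hi B - lo B) + sqrt (hi C - lo C)
      = (sqrt r1 + sqrt r2 + sqrt r3) * sqrt (hi P - lo P)"
    by (simp add: lenA lenB lenC lenP real_sqrt_mult algebra_simps)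
  also have "\<dots> \<le> 171 / 100 * sqrt (hi P - lo P)"
    using sqrt_ratios_sum_le[OF ab] unfolding r1_def r2_def r3_def
    by (intro mult_right_mono) (auto simp: lenP)
  finally have roots: "sqrt (hi A - lo A) + sqrt (hi B - lo B) + sqrt (hi C - lo C)
      \<le> 171 / 100 * sqrt (hi P - lo P)" .
  have pr: "proper A" "proper B" "proper C"
    using ab xy rpos unfolding proper_def vals by (auto simp: A_def B_def C_def)
  show thesis
  proof (cases "x < y")
    case True
    then have m: "0 < r1 * (y - x)" "0 < r2 * (y - x)" "0 < r3 * (y - x)" using rpos by auto
    have "lo A = lo P" "lo B = hi A" "lo C = hi B" "hi C = hi P"
      using m v12 True unfolding lo_def hi_def vals by linarith+
    then show thesis by (intro that[of A B C] pr pts roots)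
  next
    case False
    then have m: "r1 * (y - x) < 0" "r2 * (y - x) < 0" "r3 * (y - x) < 0"
      using rpos xy by (auto simp: mult_pos_neg)
    have "lo C = lo P" "lo B = hi C" "lo A = hi B" "hi A = hi P"
      using m v12 False unfolding lo_def hi_def vals by linarith+
    then show thesis using roots pts by (intro that[of C B A] pr) auto
  qed
qed

lemma lo_less_hi: "proper P \<Longrightarrow> lo P < hi P"
  by (auto simp: proper_def lo_def hi_def)

lemma pts_0: "pts 0 P = {lo P, hi P}"
  by (cases P) (auto simp: pts_def lo_def hi_def min_def max_def)

lemma finite_pts: "finite (pts n P)"
  by (simp add: pts_def finite_grid)

lemma pts_range:
  "proper P \<Longrightarrow> lo P \<in> pts n P \<and> hi P \<in> pts n P \<and> pts n P \<subseteq> {lo P..hi P}"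
proof (induction n arbitrary: P)
  case 0
  then show ?case using lo_less_hi[of P] by (auto simp: pts_0)
next
  case (Suc n)
  obtain P1 P2 P3 where P: "proper P1" "proper P2" "proper P3"
    "lo P1 = lo P" "lo P2 = hi P1" "lo P3 = hi P2" "hi P3 = hi P"
    "pts (Suc n) P = pts n P1 \<union> pts n P2 \<union> pts n P3"
    using proper_split[OF Suc.prems] by metis
  have "lo P1 < hi P1" "lo P2 < hi P2" "lo P3 < hi P3"
    by (simp_all add: lo_less_hi P(1-3))
  then show ?case using Suc.IH[OF P(1)] Suc.IH[OF P(2)] Suc.IH[OF P(3)] P(4-) by force
qed

section \<open>Counting grid points\<close>

text \<open>Dropping the right endpoint makes the counts additive under subdivision, since the points where
  two parts meet are then counted once.\<close>

definition lefts :: "nat \<Rightarrow> pair \<Rightarrow> real set" where "lefts n P = pts n P - {hi P}"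

lemma finite_lefts: "finite (lefts n P)"
  by (simp add: lefts_def finite_pts)

lemma lefts_range: "proper P \<Longrightarrow> lefts n P \<subseteq> {lo P..<hi P}"
  using pts_range[of P n] by (force simp: lefts_def)

lemma card_lefts_split:
  assumes "proper P1" "proper P2" "proper P3" "lo P2 = hi P1" "lo P3 = hi P2" "hi P3 = hi P"
    and "pts (Suc n) P = pts n P1 \<union> pts n P2 \<union> pts n P3"
  shows "card (lefts (Suc n) P \<inter> S)
       = card (lefts n P1 \<inter> S) + card (lefts n P2 \<inter> S) + card (lefts n P3 \<inter> S)"
proof -
  note r = pts_range[OF assms(1), of n] pts_range[OF assms(2), of n] pts_range[OF assms(3), of n]
  note lt = lo_less_hi[OF assms(1)] lo_less_hi[OF assms(2)] lo_less_hi[OF assms(3)]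
  have eq: "lefts (Suc n) P = lefts n P1 \<union> lefts n P2 \<union> lefts n P3"
    using r lt assms(4-) unfolding lefts_def by force
  have "lefts n P1 \<inter> lefts n P2 = {}" "(lefts n P1 \<union> lefts n P2) \<inter> lefts n P3 = {}"
    using lefts_range[OF assms(1), of n] lefts_range[OF assms(2), of n]
      lefts_range[OF assms(3), of n] lt assms(4-6) by fastforce+
  then show ?thesis
    unfolding eq by (subst card_Un_disjoint[symmetric]; (subst card_Un_disjoint[symmetric])?)
      (auto simp: finite_lefts intro!: arg_cong[where f = card])
qed

lemma card_lefts_0: "proper P \<Longrightarrow> card (lefts 0 P \<inter> S) = (if lo P \<in> S then 1 else 0)"
proof -
  assume "proper P"
  then have "lefts 0 P = {lo P}" using lo_less_hi[of P] by (auto simp: lefts_def pts_0)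
  then show ?thesis by auto
qed

lemma card_lefts_le: "proper P \<Longrightarrow> card (lefts n P \<inter> S) \<le> 3 ^ n"
proof (induction n arbitrary: P)
  case 0
  then show ?case by (simp add: card_lefts_0)
next
  case (Suc n)
  obtain P1 P2 P3 where P: "proper P1" "proper P2" "proper P3"
    "lo P2 = hi P1" "lo P3 = hi P2" "hi P3 = hi P"
    "pts (Suc n) P = pts n P1 \<union> pts n P2 \<union> pts n P3"
    using proper_split[OF Suc.prems] by metis
  show ?case
    unfolding card_lefts_split[OF P] using Suc.IH[OF P(1)] Suc.IH[OF P(2)] Suc.IH[OF P(3)] by simp
qed

text \<open>Each interval of level \<open>n\<close> whose left endpoint is below \<open>x\<close> counts once at level \<open>n\<close> and at
  most three times at level \<open>Suc n\<close>; the other intervals do not count at all.\<close>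

lemma card_lefts_below_Suc:
  "proper P \<Longrightarrow> card (lefts (Suc n) P \<inter> {..<x}) \<le> 3 * card (lefts n P \<inter> {..<x})"
proof (induction n arbitrary: P)
  case 0
  show ?case
  proof (cases "lo P < x")
    case True
    then show ?thesis using card_lefts_le[OF 0, of 1 "{..<x}"] 0 by (simp add: card_lefts_0)
  next
    case False
    then have "lefts (Suc 0) P \<inter> {..<x} = {}" using lefts_range[OF 0, of "Suc 0"] by force
    then show ?thesis by simp
  qed
next
  case (Suc n)
  obtain P1 P2 P3 where P: "proper P1" "proper P2" "proper P3"
    "lo P2 = hi P1" "lo P3 = hi P2" "hi P3 = hi P"
    and pts: "\<And>n. pts (Suc n) P = pts n P1 \<union> pts n P2 \<union> pts n P3"
    using proper_split[OF Suc.prems] by metis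
  show ?case
    unfolding card_lefts_split[OF P pts]
    using Suc.IH[OF P(1)] Suc.IH[OF P(2)] Suc.IH[OF P(3)] by simp
qed

text \<open>An interval free of grid points of level \<open>n\<close> meets at most one of the half-open intervals of that
  level, and this one contains \<open>3 ^ k\<close> left endpoints of level \<open>n + k\<close>.\<close>

lemma card_lefts_gap:
  "proper P \<Longrightarrow> pts n P \<inter> {x..<y} = {} \<Longrightarrow> card (lefts (n + k) P \<inter> {x..<y}) \<le> 3 ^ k"
proof (induction n arbitrary: P)
  case 0
  then show ?case by (simp add: card_lefts_le)
next
  case (Suc n)
  obtain P1 P2 P3 where P: "proper P1" "proper P2" "proper P3"
    "lo P2 = hi P1" "lo P3 = hi P2" "hi P3 = hi P"
    and pts: "\<And>n. pts (Suc n) P = pts n P1 \<union> pts n P2 \<union> pts n P3"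
    using proper_split[OF Suc.prems(1)] by metis
  have "hi P1 \<notin> {x..<y}" "hi P2 \<notin> {x..<y}"
    using Suc.prems(2) pts_range[OF P(1), of n] pts_range[OF P(2), of n] pts by auto
  then have gap: "y \<le> hi P1 \<or> (hi P1 < x \<and> y \<le> hi P2) \<or> hi P2 < x"
    by fastforce
  have lt: "lo P1 < hi P1" "lo P2 < hi P2" "lo P3 < hi P3"
    by (simp_all add: lo_less_hi P(1-3))
  have empty: "card (lefts (n + k) Q \<inter> {x..<y}) = 0" if "proper Q" "y \<le> lo Q \<or> hi Q < x" for Q
  proof -
    have "lefts (n + k) Q \<inter> {x..<y} = {}" using lefts_range[OF that(1), of "n + k"] that(2) by force
    then show ?thesis by simp
  qed
  have IH: "card (lefts (n + k) Q \<inter> {x..<y}) \<le> 3 ^ k" if "Q \<in> {P1, P2, P3}" for Q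
    using that Suc.prems(2) P(1-3) unfolding pts by (intro Suc.IH) auto
  note split = card_lefts_split[OF P pts, of "n + k" "{x..<y}"]
  from gap consider "y \<le> hi P1" | "hi P1 < x" "y \<le> hi P2" | "hi P2 < x" by blast
  then show ?case
  proof cases
    case 1
    then show ?thesis using split IH[of P1] empty[OF P(2)] empty[OF P(3)] lt P(4,5) by simp
  next
    case 2
    then show ?thesis using split IH[of P2] empty[OF P(1)] empty[OF P(3)] lt P(4,5) by simp
  next
    case 3
    then show ?thesis using split IH[of P3] empty[OF P(1)] empty[OF P(2)] lt P(4,5) by simp
  qed
qed

lemma proper_unit: "proper unit_pair" and lo_unit: "lo unit_pair = 0" and hi_unit: "hi unit_pair = 1"
  by (auto simp: proper_def lo_def hi_def val_def)

lemma Y_below_eq: "x \<le> 1 \<Longrightarrow> {y \<in> Y n. y < x} = lefts n unit_pair \<inter> {..<x}"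
  by (auto simp: Y_eq_pts lefts_def hi_unit)

text \<open>The limit exists because the normalised counts decrease, by \<open>card_lefts_below_Suc\<close>.\<close>

lemma Q_E_tendsto:
  assumes "x \<le> 1"
  shows "(\<lambda>n. real (card {y \<in> Y n. y < x}) / 3 ^ n) \<longlonglongrightarrow> Q_E x"
proof -
  let ?a = "\<lambda>n. real (card (lefts n unit_pair \<inter> {..<x})) / 3 ^ n"
  have "?a (Suc n) \<le> ?a n" for n
    using card_lefts_below_Suc[OF proper_unit, of n x] by (simp add: field_simps)
  then have "decseq ?a" by (rule decseq_SucI)
  then obtain L where "?a \<longlonglongrightarrow> L" by (rule decseq_convergent[of ?a 0]) auto
  then have "convergent ?a" by (rule convergentI)
  then show ?thesis
    using assms unfolding Q_E_def by (simp add: Y_below_eq convergent_LIMSEQ_iff)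
qed

lemma Q_E_gap:
  assumes "x \<le> y" "y \<le> 1" "Y n \<inter> {x..<y} = {}"
  shows "\<bar>Q_E y - Q_E x\<bar> \<le> (1 / 3) ^ n"
proof -
  let ?N = "\<lambda>m z. card {t \<in> Y m. t < z}"
  have bound: "\<bar>real (?N m y) / 3 ^ m - real (?N m x) / 3 ^ m\<bar> \<le> (1 / 3) ^ n" if le: "n \<le> m" for m
  proof -
    obtain k where m: "m = n + k" using le by (metis le_add_diff_inverse)
    have fin: "finite (Y m)" by (simp add: Y_eq_pts finite_pts)
    have "{t \<in> Y m. t < y} = {t \<in> Y m. t < x} \<union> (Y m \<inter> {x..<y})" using assms by auto
    moreover have "{t \<in> Y m. t < x} \<inter> (Y m \<inter> {x..<y}) = {}" by auto
    ultimately have "?N m y = ?N m x + card (Y m \<inter> {x..<y})"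
      using fin by (simp add: card_Un_disjoint)
    moreover have "Y m \<inter> {x..<y} = lefts m unit_pair \<inter> {x..<y}"
      using assms by (auto simp: Y_eq_pts lefts_def hi_unit)
    then have "card (Y m \<inter> {x..<y}) \<le> 3 ^ k"
      using card_lefts_gap[OF proper_unit, of n x y k] assms by (simp add: Y_eq_pts m)
    then have "real (card (Y m \<inter> {x..<y})) \<le> 3 ^ k"
      by (metis of_nat_le_iff of_nat_numeral of_nat_power)
    ultimately show ?thesis by (simp add: m field_simps power_add)
  qed
  have "(\<lambda>m. \<bar>real (?N m y) / 3 ^ m - real (?N m x) / 3 ^ m\<bar>) \<longlonglongrightarrow> \<bar>Q_E y - Q_E x\<bar>"
    using assms by (intro tendsto_intros Q_E_tendsto) auto
  then show ?thesis
    by (rule tendsto_upperbound) (use bound in \<open>auto simp: eventually_at_top_linorder\<close>)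
qed

section \<open>Almost every point avoids the grids\<close>

definition near :: "nat \<Rightarrow> pair \<Rightarrow> real \<Rightarrow> real set" where
  "near n P d = {lo P..hi P} \<inter> (\<Union>p\<in>pts n P. {p - d<..<p + d})"

lemma near_iff: "z \<in> near n P d \<longleftrightarrow> lo P \<le> z \<and> z \<le> hi P \<and> (\<exists>p\<in>pts n P. \<bar>z - p\<bar> < d)"
proof -
  have "z \<in> {p - d<..<p + d} \<longleftrightarrow> \<bar>z - p\<bar> < d" for p by auto
  then show ?thesis by (simp add: near_def)
qed

lemma near_lmeasurable: "near n P d \<in> lmeasurable"
  unfolding near_def
  by (intro bounded_set_imp_lmeasurable sets.Int bounded_Int disjI1)
     (auto simp: finite_pts)

text \<open>Within one part, a point close to a grid point of another part is at least as close to the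
  endpoint lying between them. Thus the estimate is subadditive over the three parts, and
  \<open>proper_split\<close> gains a factor \<open>171/100\<close> per level.\<close>

lemma measure_near_le:
  "proper P \<Longrightarrow> 0 < d \<Longrightarrow>
     measure lebesgue (near n P d) \<le> (171 / 100) ^ n * sqrt (2 * d * (hi P - lo P))"
proof (induction n arbitrary: P)
  case 0
  let ?m = "measure lebesgue (near 0 P d)"
  have lt: "lo P < hi P" using lo_less_hi[OF 0(1)] .
  have "?m \<le> measure lebesgue {lo P..hi P}"
    by (intro measure_mono_fmeasurable) (auto simp: near_def fmeasurableD[OF near_lmeasurable, unfolded near_def])
  then have 1: "?m \<le> hi P - lo P" using lt by simp
  have "?m \<le> measure lebesgue ({lo P..lo P + d} \<union> {hi P - d..hi P})"
    by (intro measure_mono_fmeasurable fmeasurableD[OF near_lmeasurable] fmeasurable.Un) (auto simp: near_def pts_0)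
  also have "\<dots> \<le> measure lebesgue {lo P..lo P + d} + measure lebesgue {hi P - d..hi P}"
    by (intro measure_Un_le) auto
  also have "\<dots> = 2 * d" using 0 by simp
  finally have 2: "?m \<le> 2 * d" .
  \<comment> \<open>The geometric mean of the two bounds; it is the root of the length that sums well.\<close>
  have "?m\<^sup>2 \<le> 2 * d * (hi P - lo P)"
    unfolding power2_eq_square using 1 2 0(2) by (intro mult_mono) auto
  then show ?case by (simp add: real_le_rsqrt)
next
  case (Suc n)
  obtain P1 P2 P3 where P: "proper P1" "proper P2" "proper P3"
    "lo P1 = lo P" "lo P2 = hi P1" "lo P3 = hi P2" "hi P3 = hi P"
    "pts (Suc n) P = pts n P1 \<union> pts n P2 \<union> pts n P3"
    and roots: "sqrt (hi P1 - lo P1) + sqrt (hi P2 - lo P2) + sqrt (hi P3 - lo P3)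
       \<le> 171 / 100 * sqrt (hi P - lo P)"
    using proper_split[OF Suc.prems(1)] by metis
  have lt: "lo P1 < hi P1" "lo P2 < hi P2" "lo P3 < hi P3"
    by (simp_all add: lo_less_hi P(1-3))
  have sub: "near (Suc n) P d \<subseteq> near n P1 d \<union> near n P2 d \<union> near n P3 d"
  proof
    fix z assume "z \<in> near (Suc n) P d"
    then obtain p where z: "lo P \<le> z" "z \<le> hi P" "\<bar>z - p\<bar> < d"
      and p: "p \<in> pts n P1 \<union> pts n P2 \<union> pts n P3"
      unfolding near_iff P(8) by blast
    \<comment> \<open>If \<open>p\<close> lies outside the part \<open>X\<close> that contains \<open>z\<close>, an endpoint of \<open>X\<close> replaces it.\<close>
    have key: "z \<in> near n X d" if "proper X" "z \<in> {lo X..hi X}" "p \<in> pts n X \<or> p \<notin> {lo X<..<hi X}" for X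
    proof -
      have "\<exists>p'\<in>pts n X. \<bar>z - p'\<bar> < d"
      proof (cases "p \<in> pts n X")
        case False
        with that have "p \<le> lo X \<or> hi X \<le> p" by auto
        then have "\<bar>z - lo X\<bar> < d \<or> \<bar>z - hi X\<bar> < d" using z that(2) by auto
        then show ?thesis using pts_range[OF that(1), of n] by blast
      qed (use z in auto)
      then show ?thesis using that(2) by (simp add: near_iff)
    qed
    note r = pts_range[OF P(1), of n] pts_range[OF P(2), of n] pts_range[OF P(3), of n]
    have alt: "p \<in> pts n P1 \<or> p \<notin> {lo P1<..<hi P1}"
      "p \<in> pts n P2 \<or> p \<notin> {lo P2<..<hi P2}" "p \<in> pts n P3 \<or> p \<notin> {lo P3<..<hi P3}"
      using p r lt P(5,6) by force+
    consider "z \<in> {lo P1..hi P1}" | "z \<in> {lo P2..hi P2}" | "z \<in> {lo P3..hi P3}"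
      using z P by fastforce
    then show "z \<in> near n P1 d \<union> near n P2 d \<union> near n P3 d"
      by cases (blast dest: key[OF P(1) _ alt(1)] key[OF P(2) _ alt(2)] key[OF P(3) _ alt(3)])+
  qed
  have "measure lebesgue (near (Suc n) P d)
      \<le> measure lebesgue (near n P1 d \<union> near n P2 d \<union> near n P3 d)"
    using sub by (intro measure_mono_fmeasurable fmeasurableD fmeasurable.Un near_lmeasurable)
  also have "\<dots> \<le> measure lebesgue (near n P1 d) + measure lebesgue (near n P2 d)
      + measure lebesgue (near n P3 d)"
    by (intro order_trans[OF measure_Un_le] add_mono measure_Un_le order_refl
        sets.Un fmeasurableD near_lmeasurable)
  also have "\<dots> \<le> (171 / 100) ^ n * sqrt (2 * d * (hi P1 - lo P1))
      + (171 / 100) ^ n * sqrt (2 * d * (hi P2 - lo P2))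
      + (171 / 100) ^ n * sqrt (2 * d * (hi P3 - lo P3))"
    by (intro add_mono Suc.IH P Suc.prems(2))
  also have "\<dots> = (171 / 100) ^ n * sqrt (2 * d)
      * (sqrt (hi P1 - lo P1) + sqrt (hi P2 - lo P2) + sqrt (hi P3 - lo P3))"
    by (simp only: real_sqrt_mult distrib_left mult.assoc)
  also have "\<dots> \<le> (171 / 100) ^ n * sqrt (2 * d) * (171 / 100 * sqrt (hi P - lo P))"
    using roots Suc.prems(2) by (intro mult_left_mono) auto
  also have "\<dots> = (171 / 100) ^ Suc n * sqrt (2 * d * (hi P - lo P))"
    by (simp add: real_sqrt_mult)
  finally show ?case .
qed

text \<open>The radius \<open>(17/50) ^ n\<close> exceeds \<open>3 ^ (-n)\<close> by an exponential factor and is still summable by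
  \<open>measure_near_le\<close>, because \<open>(171/100)\<^sup>2 * 17/50 < 1\<close>.\<close>

lemma AE_eventually_far:
  "AE x in lebesgue_on {0..1}. \<forall>\<^sub>F n in sequentially. \<forall>p\<in>Y n. (17 / 50) ^ n \<le> \<bar>x - p\<bar>"
proof -
  let ?B = "\<lambda>n. near n unit_pair ((17 / 50) ^ n)"
  have sub: "?B n \<subseteq> {0..1}" for n by (auto simp: near_def lo_unit hi_unit)
  have sets: "?B n \<in> sets (lebesgue_on {0..1})" for n
    using sub fmeasurableD[OF near_lmeasurable] by (auto simp: sets_restrict_space_iff)
  have em: "emeasure (lebesgue_on {0..1}) (?B n) = emeasure lebesgue (?B n)" for n
    by (intro emeasure_restrict_space sub) auto
  have bound: "measure (lebesgue_on {0..1}) (?B n) \<le> sqrt 2 * (171 / 100 * sqrt (17 / 50)) ^ n" for n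
  proof -
    have "measure lebesgue (?B n) \<le> (171 / 100) ^ n * sqrt (2 * (17 / 50) ^ n)"
      using measure_near_le[OF proper_unit, of "(17 / 50) ^ n" n] by (simp add: lo_unit hi_unit)
    also have "\<dots> = sqrt 2 * (171 / 100 * sqrt (17 / 50)) ^ n"
      by (simp only: real_sqrt_mult real_sqrt_power power_mult_distrib mult.assoc mult.left_commute)
    finally show ?thesis by (simp add: measure_def em)
  qed
  have "171 / 100 * sqrt (17 / 50) < (1 :: real)"
    by (rule power2_less_imp_less) (auto simp: power_mult_distrib power_divide)
  then have geom: "summable (\<lambda>n. sqrt 2 * (171 / 100 * sqrt (17 / 50)) ^ n :: real)"
    by (intro summable_mult summable_geometric) (simp add: abs_mult)
  have sum: "summable (\<lambda>n. measure (lebesgue_on {0..1}) (?B n))"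
    by (rule summable_comparison_test'[OF geom]) (simp only: real_norm_def abs_of_nonneg measure_nonneg bound)
  have fin: "emeasure (lebesgue_on {0..1}) (?B n) < \<infinity>" for n
    unfolding em using fmeasurableD2[OF near_lmeasurable] by (simp only: less_top infinity_ennreal_def)
  have "AE x in lebesgue_on {0..1}. \<forall>\<^sub>F n in sequentially. x \<in> space (lebesgue_on {0..1}) - ?B n"
    by (rule borel_cantelli_AE1[OF sets fin sum])
  then show ?thesis
  proof (rule AE_mp, intro AE_I2 impI)
    fix x :: real
    assume ev: "\<forall>\<^sub>F n in sequentially. x \<in> space (lebesgue_on {0..1}) - ?B n"
    show "\<forall>\<^sub>F n in sequentially. \<forall>p\<in>Y n. (17 / 50) ^ n \<le> \<bar>x - p\<bar>"
      using ev by eventually_elim (force simp: near_iff lo_unit hi_unit Y_eq_pts space_restrict_space)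
  qed
qed

section \<open>The derivative\<close>

text \<open>The constant \<open>50/51\<close> is \<open>(1/3) / (17/50)\<close>, the factor per level by which the variation of \<open>Q_E\<close> is
  smaller than the distance; the \<open>3\<close> comes from comparing levels \<open>n - 1\<close> and \<open>n\<close>.\<close>

lemma Q_E_derivative_zero:
  assumes x: "x \<in> {0..1}"
    and far: "\<forall>\<^sub>F n in sequentially. \<forall>p\<in>Y n. (17 / 50) ^ n \<le> \<bar>x - p\<bar>"
  shows "(Q_E has_real_derivative 0) (at x within {0..1})"
proof -
  have key: "\<exists>d>0. \<forall>y\<in>{0..1}. \<bar>y - x\<bar> < d \<longrightarrow> \<bar>Q_E y - Q_E x\<bar> \<le> e * \<bar>y - x\<bar>"
    if "0 < e" for e :: real
  proof -
    have lim: "(\<lambda>n. 3 * (50 / 51 :: real) ^ n) \<longlonglongrightarrow> 3 * 0"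
      by (intro tendsto_intros LIMSEQ_power_zero) auto
    have "\<forall>\<^sub>F n in sequentially. 3 * (50 / 51 :: real) ^ n < e"
      by (rule order_tendstoD(2)[OF lim]) (use that in simp)
    with far have "\<forall>\<^sub>F n in sequentially. (\<forall>p\<in>Y n. (17 / 50) ^ n \<le> \<bar>x - p\<bar>) \<and>
        3 * (50 / 51 :: real) ^ n < e" by (rule eventually_conj)
    then obtain N where N: "\<And>n p. N \<le> n \<Longrightarrow> p \<in> Y n \<Longrightarrow> (17 / 50) ^ n \<le> \<bar>x - p\<bar>"
      "\<And>n. N \<le> n \<Longrightarrow> 3 * (50 / 51 :: real) ^ n < e"
      unfolding eventually_sequentially by blast
    have "\<bar>Q_E y - Q_E x\<bar> \<le> e * \<bar>y - x\<bar>" if y: "y \<in> {0..1}" "\<bar>y - x\<bar> < (17 / 50) ^ N" for y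
    proof -
      \<comment> \<open>The grid points in \<open>S\<close> are those that the counts at \<open>x\<close> and at \<open>y\<close> tell apart.\<close>
      define S where "S = {min x y..<max x y}"
      have Sd: "\<bar>x - p\<bar> \<le> \<bar>y - x\<bar>" if "p \<in> S" for p
        using that by (auto simp: S_def min_def max_def split: if_splits)
      have gap: "\<bar>Q_E y - Q_E x\<bar> \<le> (1 / 3) ^ n" if "Y n \<inter> S = {}" for n
        using Q_E_gap[of "min x y" "max x y" n] that x y
        by (auto simp: S_def min_def max_def abs_minus_commute split: if_splits)
      show ?thesis
      proof (cases "\<exists>k. Y (N + k) \<inter> S \<noteq> {}")
        case True
        define k where "k = (LEAST k. Y (N + k) \<inter> S \<noteq> {})"
        have k: "Y (N + k) \<inter> S \<noteq> {}" unfolding k_def using True by (rule LeastI_ex)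
        \<comment> \<open>\<open>y\<close> is too close to \<open>x\<close> to be separated at level \<open>N\<close>, so there is a level before \<open>N + k\<close>.\<close>
        have "Y N \<inter> S = {}" using N(1)[of N] Sd y(2) by fastforce
        then obtain j where j: "k = Suc j" using k by (cases k) auto
        have "Y (N + j) \<inter> S = {}" using not_less_Least[of j "\<lambda>k. Y (N + k) \<inter> S \<noteq> {}"] j k_def by auto
        then have "\<bar>Q_E y - Q_E x\<bar> \<le> (1 / 3) ^ (N + j)" by (rule gap)
        also have "\<dots> = 3 * (50 / 51) ^ (N + k) * (17 / 50) ^ (N + k)"
          by (simp add: j power_mult_distrib[symmetric] flip: mult.assoc)
        also have "\<dots> \<le> e * \<bar>y - x\<bar>"
        proof (intro mult_mono)
          obtain p where "p \<in> Y (N + k)" "p \<in> S" using k by blast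
          then show "(17 / 50) ^ (N + k) \<le> \<bar>y - x\<bar>" using N(1)[of "N + k" p] Sd[of p] by force
        qed (use N(2)[of "N + k"] \<open>0 < e\<close> in auto)
        finally show ?thesis .
      next
        case False
        then have le: "\<bar>Q_E y - Q_E x\<bar> \<le> (1 / 3) ^ (N + k)" for k
          using gap[of "N + k"] by simp
        have "(\<lambda>k. (1 / 3 :: real) ^ (N + k)) \<longlonglongrightarrow> 0"
          unfolding power_add by (intro tendsto_mult_right_zero LIMSEQ_power_zero) simp
        then have "\<bar>Q_E y - Q_E x\<bar> \<le> 0"
          by (rule LIMSEQ_le_const) (use le in blast)
        then show ?thesis using \<open>0 < e\<close> by simp
      qed
    qed
    then show ?thesis by (intro exI[of _ "(17 / 50) ^ N"]) auto
  qed
  have "(Q_E has_derivative (\<lambda>h. 0 * h)) (at x within {0..1})"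
    unfolding has_derivative_within_alt
    by (intro conjI bounded_linear_mult_right) (use key in simp)
  then show ?thesis unfolding has_field_derivative_def .
qed

theorem theorem3:
  "AE x in lebesgue_on {0..1}. (Q_E has_real_derivative 0) (at x within {0..1})"
  by (rule AE_mp[OF AE_eventually_far], intro AE_I2 impI Q_E_derivative_zero) simp_all

end
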